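(* Let $H_n^{(3)}=\sum_{j=1}^n \frac{1}{j^3}$ and $(x)_k=x(x+1)\cdots(x+k-1)$ (with $(x)_0=1$). Then \[ \sum_{k=1}^{\infty}\frac{6k+1}{4^k}\frac{(\frac{1}{2})_k^3(\frac{1}{4})_k}{(1)_k^4}\Big\{64H_{2k}^{(3)}-7H_{k}^{(3)}\Big\} =\frac{\sqrt{2}\,\Gamma(\frac{1}{4})^2}{\pi^{5/2}}\Big\{29\zeta(3)-\pi^3\Big\}, \] where $\Gamma$ is the Euler gamma function and $\zeta(3)=\sum_{k=1}^\infty k^{-3}$.
   Context: $(x)_k$ denotes the rising factorial (shifted factorial). $H_n^{(3)}$ is the harmonic number of order 3. *)

theory Defs
  imports "HOL-Analysis.Analysis"
begin

definition harm3 :: "nat \<Rightarrow> real"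
  where "harm3 n = (\<Sum>j=1..n. 1 / real j ^ 3)"

(* The series starts at 1, hence the shifted index; its terms are nonnegative and
   it converges, so suminf denotes the actual value. *)
definition zeta3 :: real
  where "zeta3 = (\<Sum>k. 1 / real (Suc k) ^ 3)"

end

theory Submission
  imports Defs "HOL-Real_Asymp.Real_Asymp"
begin

text \<open>
  Put a cubic deformation parameter \<open>u\<close> into the base series: replace each factor
  \<open>((j + 1/2) / (j + 1))^3\<close> by \<open>((j + 1/2)^3 + u) / ((j + 1)^3 -
  u/8)\<close>. With \<open>u = x^3\<close> this shifts the three upper parameters by
  \<open>x\<close>, \<open>\<omega> x\<close>, \<open>\<omega>^2 x\<close> (a case of Rahman's
  quadratic summation), and the \<open>u\<close>-derivative at \<open>0\<close> of the
  \<open>k\<close>-th term produces exactly the factor \<open>(64 H_{2k} - 7 H_k) / 8\<close>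
  of third-order harmonic numbers. The deformed series belongs to a family \<open>S n u\<close>
  (upper parameters shifted by \<open>2n\<close>) for which a WZ certificate gives \<open>S n u
  = ratio n u * S (n+1) u\<close>. The logarithmic derivative of \<open>S n\<close> at
  \<open>0\<close> tends to \<open>0\<close>, so for \<open>n = 0\<close> it is the sum of the
  logarithmic derivatives of the ratios, a sum of reciprocal cubes of \<open>j + 3/4\<close>
  and \<open>j + 1\<close> that is evaluated by the reflection formula for the polygamma
  function.

  The undeformed sum is the nonterminating case \<open>a = b = c = 1/4\<close> of Gosper's strange 5F4
  evaluation. Varying \<open>c\<close>, the sums at \<open>c - n\<close> have a limit independent of \<open>c\<close>, and at
  \<open>c = 0\<close> the series terminates; a first-order recurrence in \<open>c\<close> then transports the value.
\<close>

subsection \<open>The cubic deformation\<close>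

text \<open>
  Numerator of the WZ certificate, found with Gosper's algorithm; it is evaluated at
  \<open>y = 2n + k + 1/2\<close>, which keeps its coefficients integral.
\<close>

definition cert_poly :: "real \<Rightarrow> real \<Rightarrow> real \<Rightarrow> real" where
  "cert_poly k y u =
     k^2 * (21*y^4 + 26*y^3 + 6*y^2 - 6*y*u - 3*y - u - 1)
     - k * (54*y^5 + 72*y^4 + 18*y^3 - 27*y^2*u - 9*y^2 - 9*y*u - 3*y)
     + 37*y^6 + 54*y^5 + 15*y^4 - 43*y^3*u - 8*y^3 - 27*y^2*u - 3*y^2 - 3*y*u + u^2 + u"

text \<open>The telescoping relation behind \<open>partial_sum_recursion\<close>, divided by the
  common weight and cleared of denominators. With \<open>y = 2n + k + 1/2\<close>, the factor
  \<open>(y-k)^3 + u\<close> is \<open>upper n u 0\<close> and \<open>(2*y+1)^3 - u\<close> is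
  \<open>8 * lower n u k\<close>.\<close>

lemma cert_poly_identity:
  "((y-k)^3 + u) * (3*y-1) * ((2*y+1)^3 - u) * ((2*y+3)^3 - u)
   - (3*y+5) * (3*y-k-1) * (3*y-k+1) * (3*y-k+3) * (y^3+u) * ((y+1)^3+u)
   = (3*y-k-1) * (y^3+u) * cert_poly (k+1) (y+1) u - k * ((2*y+3)^3 - u) * cert_poly k y u"
  unfolding cert_poly_def by algebra

definition upper :: "nat \<Rightarrow> real \<Rightarrow> nat \<Rightarrow> real" where
  "upper n u j = (2 * real n + real j + 1/2)^3 + u"

text \<open>For \<open>u = x^3\<close> this is the product of \<open>2n + j + 1 - w*x/2\<close> over
  the three cube roots of unity \<open>w\<close>, while \<open>upper\<close> is the product of
  \<open>2n + j + 1/2 + w*x\<close>.\<close>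

definition lower :: "nat \<Rightarrow> real \<Rightarrow> nat \<Rightarrow> real" where
  "lower n u j = (2 * real n + real j + 1)^3 - u / 8"

text \<open>
  The summand of \<open>S n u\<close> is \<open>linfac n k * weight n u k\<close>.
\<close>

definition weight :: "nat \<Rightarrow> real \<Rightarrow> nat \<Rightarrow> real" where
  "weight n u k = pochhammer (3 * real n + 1/4) k / (fact k * 4^k) * (\<Prod>j<k. upper n u j / lower n u j)"

definition linfac :: "nat \<Rightarrow> nat \<Rightarrow> real" where
  "linfac n k = 6 * real n + 3 * real k + 1/2"

text \<open>The factor with \<open>3/4\<close> is \<open>upper n u 1 / 8\<close>; it is the source
  of the reciprocal cubes of \<open>n + 3/4\<close>.\<close>

definition ratio :: "nat \<Rightarrow> real \<Rightarrow> real" where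
  "ratio n u = pochhammer (3 * real n + 1/4) 3 * ((real n + 3/4)^3 + u/8) / (lower n u 0 * lower n u 1)"

text \<open>The factor \<open>real k\<close> makes the telescoped sum vanish at its lower
  end.\<close>

definition cert :: "nat \<Rightarrow> real \<Rightarrow> nat \<Rightarrow> real" where
  "cert n u k = real k * cert_poly (real k) (2 * real n + real k + 1/2) u / (8 * upper n u 0 * lower n u k)"

text \<open>The radius \<open>1/8\<close> is the cube of the smallest base \<open>1/2\<close>, which
  occurs at \<open>n = j = 0\<close>.\<close>

lemma upper_pos: "\<bar>u\<bar> < 1/8 \<Longrightarrow> upper n u j > 0"
proof -
  assume "\<bar>u\<bar> < 1/8"
  moreover have "(1/2)^3 \<le> (2 * real n + real j + 1/2)^3"
    by (rule power_mono) auto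
  ultimately show ?thesis by (simp add: upper_def power3_eq_cube)
qed

lemma lower_pos: "\<bar>u\<bar> < 1/8 \<Longrightarrow> lower n u j > 0"
proof -
  assume "\<bar>u\<bar> < 1/8"
  moreover have "1^3 \<le> (2 * real n + real j + 1)^3"
    by (rule power_mono) auto
  ultimately show ?thesis by (simp add: lower_def power3_eq_cube)
qed

section \<open>Contiguous relations for the weights and telescoping in \<open>n\<close>\<close>

lemma weight_Suc:
  "weight n u (Suc k) =
     weight n u k * ((3 * real n + 1/4 + real k) * upper n u k / (4 * (real k + 1) * lower n u k))"
  by (simp add: weight_def pochhammer_Suc field_simps)

text \<open>Raising \<open>n\<close> by one shifts the cubic factors by two places and the
  Pochhammer parameter by three. The products for \<open>n\<close> and \<open>Suc n\<close>
  therefore overlap except for two cubic factors at either end and three linear ones; the quotient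
  of the weights is stated cross-multiplied.\<close>

lemma weight_shift:
  assumes u: "\<bar>u\<bar> < 1/8"
  shows "weight (Suc n) u k * (pochhammer (3 * real n + 1/4) 3 * upper n u 0 * upper n u 1
           * lower n u k * lower n u (Suc k))
       = weight n u k * (pochhammer (3 * real n + 1/4 + real k) 3 * upper n u k * upper n u (Suc k)
           * lower n u 0 * lower n u 1)"
proof (induction k)
  case 0
  then show ?case by (simp add: weight_def)
next
  case (Suc k)
  have nz: "lower n u k > 0" "lower n u (Suc k) > 0" "lower n u (Suc (Suc k)) > 0"
    using lower_pos[OF u] by auto
  have sh: "upper (Suc n) u k = upper n u (Suc (Suc k))" "lower (Suc n) u k = lower n u (Suc (Suc k))"
    by (simp_all add: upper_def lower_def algebra_simps)
  define x where "x = 3 * real n + 1/4 + real k"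
  have p: "pochhammer (3 * real n + 1/4 + real k) 3 = x * (x+1) * (x+2)"
    "pochhammer (3 * real n + 1/4 + real (Suc k)) 3 = (x+1) * (x+2) * (x+3)"
    "3 * real (Suc n) + 1/4 + real k = x + 3"
    by (simp_all add: numeral_3_eq_3 pochhammer_Suc x_def algebra_simps)
  define C where "C = pochhammer (3 * real n + 1/4) 3 * upper n u 0 * upper n u 1"
  define E where "E = lower n u 0 * lower n u 1"
  have IH: "weight (Suc n) u k * (C * lower n u k * lower n u (Suc k))
       = weight n u k * (x * (x+1) * (x+2) * upper n u k * upper n u (Suc k) * E)"
    using Suc unfolding p C_def E_def by (simp only: mult.assoc)
  have "weight (Suc n) u (Suc k) * (C * lower n u (Suc k) * lower n u (Suc (Suc k)))
      = (weight (Suc n) u k * (C * lower n u k * lower n u (Suc k))) *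
          ((x + 3) * upper n u (Suc (Suc k)) / (4 * (real k + 1) * lower n u k))"
  proof -
    have "W * ((x+3) * e / (4 * K * l2)) * (C * l1 * l2) = W * (C * l0 * l1) * ((x+3) * e / (4 * K * l0))"
      if "K > 0" "l0 > 0" "l2 > 0" for W e K l0 l1 l2
      using that by (simp add: divide_simps)
    then show ?thesis
      using nz unfolding weight_Suc[of "Suc n"] sh p by simp
  qed
  also have "\<dots> = weight n u (Suc k) * ((x+1) * (x+2) * (x+3) * upper n u (Suc k) * upper n u (Suc (Suc k)) * E)"
    unfolding IH weight_Suc[of n] x_def[symmetric] by simp
  finally show ?case unfolding p C_def E_def by (simp only: mult.assoc)
qed

text \<open>The WZ step: the difference of the two summands is the forward difference of
  \<open>cert n u k * weight n u k\<close>. Keeping \<open>N\<close> finite allows differentiation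
  in \<open>u\<close> before the limit is taken.\<close>

lemma partial_sum_recursion:
  assumes u: "\<bar>u\<bar> < 1/8"
  shows "(\<Sum>k<N. linfac n k * weight n u k) =
           ratio n u * (\<Sum>k<N. linfac (Suc n) k * weight (Suc n) u k) + cert n u N * weight n u N"
proof (induction N)
  case 0
  then show ?case by (simp add: cert_def)
next
  case (Suc N)
  define k where "k = real N"
  define y where "y = 2 * real n + real N + 1/2"
  define V where "V = weight n u N"
  define e0 where "e0 = upper n u 0"
  define eN where "eN = upper n u N"
  define eN1 where "eN1 = upper n u (Suc N)"
  define dN where "dN = lower n u N"
  define dN1 where "dN1 = lower n u (Suc N)"
  define p where "p = 3 * real n + 1/4 + real N"
  define p3 where "p3 = pochhammer (3 * real n + 1/4) 3"
  have pos: "e0 > 0" "dN > 0" "dN1 > 0" "lower n u 0 > 0" "lower n u 1 > 0" "upper n u 1 > 0"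
    using lower_pos[OF u] upper_pos[OF u] by (auto simp: e0_def dN_def dN1_def)
  have p3pos: "p3 > 0" unfolding p3_def by (rule pochhammer_pos) simp
  have kpos: "k + 1 > 0" by (simp add: k_def)
  have ye: "e0 = (y-k)^3 + u" "eN = y^3 + u" "eN1 = (y+1)^3 + u"
      "8 * dN = (2*y+1)^3 - u" "8 * dN1 = (2*y+3)^3 - u"
      "2 * p = 3*y - k - 1" "2 * (p + 1) = 3*y-k+1" "2 * (p+2) = 3*y-k+3"
    unfolding e0_def eN_def eN1_def dN_def dN1_def upper_def lower_def y_def k_def p_def
    by (simp_all add: power3_eq_cube algebra_simps)
  define q where "q = cert_poly k y u"
  define q' where "q' = cert_poly (k+1) (y+1) u"
  \<comment> \<open>The multiples by 2 and 8 turn all factors into the polynomials of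
    \<open>cert_poly_identity\<close>.\<close>
  have id: "e0 * (3*y-1) * (8*dN) * (8*dN1)
   - (3*y+5) * (2*p) * (2*(p+1)) * (2*(p+2)) * eN * eN1
   = (2*p) * eN * q' - k * (8*dN1) * q"
    unfolding ye q_def q'_def by (rule cert_poly_identity)
  have ratio: "ratio n u * weight (Suc n) u N = V * (p*(p+1)*(p+2)) * eN * eN1 / (8 * e0 * dN * dN1)"
  proof -
    have "weight (Suc n) u N * (p3 * e0 * upper n u 1 * dN * dN1)
       = V * (p*(p+1)*(p+2) * eN * eN1 * lower n u 0 * lower n u 1)"
      using weight_shift[OF u, of n N]
      unfolding p3_def[symmetric] e0_def[symmetric] eN_def[symmetric] eN1_def[symmetric] dN_def[symmetric]
        dN1_def[symmetric] V_def[symmetric]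
      by (simp add: numeral_3_eq_3 pochhammer_Suc p_def algebra_simps)
    moreover have "ratio n u = p3 * (upper n u 1 / 8) / (lower n u 0 * lower n u 1)"
      by (simp add: ratio_def p3_def upper_def power3_eq_cube field_simps)
    moreover have "r * w = V * P * eN * eN1 / (8 * e0 * dN * dN1)"
      if "w * (p3 * e0 * e1 * dN * dN1) = V * (P * eN * eN1 * d0 * d1)" "r = p3 * (e1 / 8) / (d0 * d1)"
        "d0 > 0" "d1 > 0" "e1 > 0" for w P e1 d0 d1 r
    proof -
      have "w = V * (P * eN * eN1 * d0 * d1) / (p3 * e0 * e1 * dN * dN1)"
        using that pos p3pos by (simp add: eq_divide_eq)
      then show ?thesis using that pos p3pos by simp
    qed
    ultimately show ?thesis using pos by blast
  qed
  have VS: "weight n u (Suc N) = V * (p * eN / (4 * (k+1) * dN))"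
    unfolding weight_Suc V_def p_def eN_def dN_def k_def by simp
  have c: "cert n u N = k * q / (8 * e0 * dN)"
    by (simp add: cert_def k_def q_def y_def e0_def dN_def)
  have c': "cert n u (Suc N) = (k + 1) * q' / (8 * e0 * dN1)"
    unfolding cert_def k_def q'_def y_def e0_def dN1_def by (simp add: algebra_simps)
  have l: "linfac n N = 3*y-1" "linfac (Suc n) N = 3*y+5"
    by (simp_all add: linfac_def y_def algebra_simps)
  have "linfac n N * V - linfac (Suc n) N * (ratio n u * weight (Suc n) u N)
      = V * (e0 * (3*y-1) * (8*dN) * (8*dN1)
   - (3*y+5) * (2*p) * (2*(p+1)) * (2*(p+2)) * eN * eN1) / (64 * e0 * dN * dN1)"
    unfolding l ratio using pos by (simp add: field_simps)
  also have "\<dots> = V * ((2*p) * eN * q' - k * (8*dN1) * q) / (64 * e0 * dN * dN1)"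
    unfolding id ..
  also have "\<dots> = cert n u (Suc N) * weight n u (Suc N) - cert n u N * V"
  proof -
    have "K * q' / (8 * e0 * dN1) * (V * (p * eN / (4 * K * dN))) = V * (2 * p * eN * q') / (64 * e0 * dN * dN1)"
      if "K > 0" for K using that pos by (simp add: divide_simps)
    from this[OF kpos] show ?thesis
      unfolding c c' VS using pos by (simp only:) (simp add: right_diff_distrib diff_divide_distrib mult_ac)
  qed
  finally show ?case
    using Suc by (simp add: V_def[symmetric] algebra_simps)
qed

section \<open>Logarithmic derivative of the summand at \<open>u = 0\<close>\<close>

definition harm_sum :: "nat \<Rightarrow> nat \<Rightarrow> real" where
  "harm_sum n k = (\<Sum>j<k. 1 / (2 * real n + real j + 1/2)^3 + 1 / (8 * (2 * real n + real j + 1)^3))"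

text \<open>Logarithmic differentiation factor by factor: the numerator \<open>x^3 + u\<close>
  contributes \<open>1/x^3\<close>, the denominator \<open>z^3 - u/8\<close> contributes
  \<open>1/(8*z^3)\<close>.\<close>

lemma weight_deriv:
  "((\<lambda>u. weight n u k) has_real_derivative weight n 0 k * harm_sum n k) (at 0)"
proof (induction k)
  case 0
  then show ?case by (simp add: weight_def harm_sum_def)
next
  case (Suc k)
  define x where "x = 2 * real n + real k + 1/2"
  define z where "z = 2 * real n + real k + 1"
  have pos: "x > 0" "z > 0" by (auto simp: x_def z_def)
  have d: "((\<lambda>u. c * (x^3 + u) / (d * (z^3 - u/8)))
      has_real_derivative c * x^3 / (d * z^3) * (1/x^3 + 1/(8*z^3))) (at 0)" if "d > 0" for c d
    using pos that by (auto intro!: derivative_eq_intros simp: field_simps)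
  have "((\<lambda>u. (3 * real n + 1/4 + real k) * upper n u k / (4 * (real k + 1) * lower n u k))
      has_real_derivative (3 * real n + 1/4 + real k) * upper n 0 k / (4 * (real k + 1) * lower n 0 k) * (1/x^3 + 1/(8*z^3))) (at 0)"
    using d[of "4 * (real k + 1)" "3 * real n + 1/4 + real k"]
    unfolding upper_def lower_def x_def[symmetric] z_def[symmetric] by simp
  note DERIV_mult[OF Suc this]
  moreover have "harm_sum n (Suc k) = harm_sum n k + (1/x^3 + 1/(8*z^3))"
    by (simp add: harm_sum_def x_def z_def)
  moreover have "W * h * F + F * c * W = W * F * (h + c)" for W h F c :: real
    by (simp add: algebra_simps)
  ultimately show ?case
    unfolding weight_Suc by (simp only:)
qed

subsection \<open>Inverse cubes and the polygamma function\<close>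

lemma Gamma_reflection_real:
  fixes x :: real
  shows "Gamma x * Gamma (1 - x) = pi / sin (pi * x)"
proof -
  \<comment> \<open>No exception at integers: there one Gamma factor is at a pole and has value 0,
    and the right side is a division by 0.\<close>
  have "complex_of_real (Gamma x * Gamma (1 - x)) = complex_of_real (pi / sin (pi * x))"
    using Gamma_reflection_complex[of "of_real x"]
    by (simp flip: Gamma_complex_of_real sin_of_real)
  then show ?thesis by (simp only: of_real_eq_iff)
qed

text \<open>Differentiate \<open>Gamma t * Gamma (1 - t) * sin (pi * t)\<close>, which is the
  constant \<open>pi\<close> on the unit interval.\<close>

lemma Digamma_reflection_real:
  fixes x :: real
  assumes "0 < x" "x < 1"
  shows "Digamma (1 - x) - Digamma x = pi * cos (pi * x) / sin (pi * x)"
proof -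
  let ?g = "\<lambda>t::real. Gamma t * Gamma (1 - t) * sin (pi * t)"
  have nn: "x \<notin> \<int>\<^sub>\<le>\<^sub>0" "1 - x \<notin> \<int>\<^sub>\<le>\<^sub>0" using assms by (auto elim!: nonpos_Ints_cases)
  have s: "sin (pi * t) > 0" if "0 < t" "t < 1" for t using that by (intro sin_gt_zero) auto
  have "(?g has_real_derivative
      Gamma x * Gamma (1 - x) * ((Digamma x - Digamma (1 - x)) * sin (pi * x) + pi * cos (pi * x))) (at x)"
    using nn by (auto intro!: derivative_eq_intros simp: algebra_simps)
  moreover have "(?g has_real_derivative 0) (at x)"
  proof (rule has_field_derivative_transform_within_open[where S = "{0<..<1}"])
    show "((\<lambda>_. pi) has_real_derivative 0) (at x)" by simp
    show "pi = ?g t" if "t \<in> {0<..<1}" for t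
      using s[of t] that by (simp add: Gamma_reflection_real)
  qed (use assms in auto)
  ultimately have "Gamma x * Gamma (1 - x) * ((Digamma x - Digamma (1 - x)) * sin (pi * x) + pi * cos (pi * x)) = 0"
    by (rule DERIV_unique)
  moreover have "Gamma x > 0" "Gamma (1 - x) > 0" using assms by (auto intro: Gamma_real_pos)
  ultimately have "(Digamma x - Digamma (1 - x)) * sin (pi * x) + pi * cos (pi * x) = 0"
    by simp
  then show ?thesis using s[OF assms] by (simp add: field_simps)
qed

text \<open>Two further differentiations of the Digamma reflection; at each stage both sides are
  derivatives of the same function near the point.\<close>

lemma Polygamma_2_reflection_real:
  fixes x :: real
  assumes "0 < x" "x < 1"
  shows "Polygamma 2 (1 - x) - Polygamma 2 x = 2 * pi^3 * cos (pi * x) / sin (pi * x)^3"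
proof -
  have nn: "t \<notin> \<int>\<^sub>\<le>\<^sub>0" "1 - t \<notin> \<int>\<^sub>\<le>\<^sub>0" if "0 < t" "t < 1" for t :: real
    using that by (auto elim!: nonpos_Ints_cases)
  have s: "sin (pi * t) > 0" if "0 < t" "t < 1" for t using that by (intro sin_gt_zero) auto
  have 1: "- Polygamma 1 (1 - t) - Polygamma 1 t = - (pi^2) / sin (pi * t)^2" if t: "0 < t" "t < 1" for t :: real
  proof -
    have "((\<lambda>t. pi * cos (pi * t) / sin (pi * t)) has_real_derivative
        (pi * (- sin (pi * t) * pi) * sin (pi * t) - pi * cos (pi * t) * (cos (pi * t) * pi)) / (sin (pi * t) * sin (pi * t))) (at t)"
      using s[OF t] by (auto intro!: derivative_eq_intros)
    also have "(pi * (- sin (pi * t) * pi) * sin (pi * t) - pi * cos (pi * t) * (cos (pi * t) * pi)) / (sin (pi * t) * sin (pi * t))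
        = - (pi^2) / sin (pi * t)^2"
    proof -
      have "pi * (- S * pi) * S - pi * C * (C * pi) = - (pi^2) * (S^2 + C^2)" for S C :: real
        by (simp add: power2_eq_square algebra_simps)
      from this[of "sin (pi * t)" "cos (pi * t)"] show ?thesis
        by (simp only: sin_cos_squared_add mult_1_right) (simp add: power2_eq_square)
    qed
    finally have "((\<lambda>t. pi * cos (pi * t) / sin (pi * t)) has_real_derivative - (pi^2) / sin (pi * t)^2) (at t)" .
    moreover have "((\<lambda>t. pi * cos (pi * t) / sin (pi * t)) has_real_derivative
        - Polygamma 1 (1 - t) - Polygamma 1 t) (at t)"
    proof (rule has_field_derivative_transform_within_open[where S = "{0<..<1}"])
      show "((\<lambda>t. Digamma (1 - t) - Digamma t) has_real_derivative - Polygamma 1 (1 - t) - Polygamma 1 t) (at t)"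
        using nn[OF t] by (auto intro!: derivative_eq_intros)
    qed (use t Digamma_reflection_real in auto)
    ultimately show ?thesis using DERIV_unique by blast
  qed
  have "((\<lambda>t. - (pi^2) / sin (pi * t)^2) has_real_derivative 2 * pi^3 * cos (pi * x) / sin (pi * x)^3) (at x)"
    using s[OF assms] by (auto intro!: derivative_eq_intros simp: power2_eq_square power3_eq_cube field_simps)
  moreover have "((\<lambda>t. - (pi^2) / sin (pi * t)^2) has_real_derivative
        Polygamma 2 (1 - x) - Polygamma 2 x) (at x)"
  proof (rule has_field_derivative_transform_within_open[where S = "{0<..<1}"])
    show "((\<lambda>t. - Polygamma 1 (1 - t) - Polygamma 1 t) has_real_derivative Polygamma 2 (1 - x) - Polygamma 2 x) (at x)"
      using nn[OF assms] by (auto intro!: derivative_eq_intros simp: numeral_2_eq_2)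
  qed (use assms 1 in auto)
  ultimately show ?thesis using DERIV_unique by blast
qed

text \<open>Write \<open>h\<close>, \<open>q1\<close>, \<open>q3\<close> for the sums with offsets
  1/2, 1/4, 3/4. Splitting by parity gives \<open>zeta3 = (h + zeta3)/8\<close> and
  \<open>h = (q1 + q3)/8\<close>, hence \<open>q1 + q3 = 56 * zeta3\<close>; reflection at 1/4 gives
  \<open>q3 - q1 = -2 * pi^3\<close>.\<close>

lemma sum_inverse_cubes_three_quarters:
  "(\<lambda>n. 1 / (real n + 3/4)^3) sums (28 * zeta3 - pi^3)"
proof -
  have ps: "(\<lambda>k. 1 / (x + real k)^3) sums (- Polygamma 2 x / 2)" if "x > 0" for x :: real
  proof -
    \<comment> \<open>Order 2 belongs to exponent 3, with sign -1 and divisor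
      \<open>fact 2\<close>.\<close>
    have "(\<lambda>k. inverse ((x + of_nat k)^Suc 2)) sums ((-1) ^ Suc 2 * Polygamma 2 x / fact 2)"
      by (rule Polygamma_LIMSEQ) (use that in auto)
    then show ?thesis by (simp add: inverse_eq_divide numeral_2_eq_2 numeral_3_eq_3)
  qed
  have z: "(\<lambda>k. 1 / (real k + 1)^3) sums zeta3"
    using ps[of 1] by (simp add: zeta3_def sums_iff add.commute)
  have q1: "(\<lambda>k. 1 / (real k + 1/4)^3) sums (- Polygamma 2 (1/4) / 2)"
    and q3: "(\<lambda>k. 1 / (real k + 3/4)^3) sums (- Polygamma 2 (3/4) / 2)"
    and h: "(\<lambda>k. 1 / (real k + 1/2)^3) sums (- Polygamma 2 (1/2) / 2)"
    using ps[of "1/4"] ps[of "3/4"] ps[of "1/2"] by (simp_all add: add.commute)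
  have grp: "(\<lambda>n. f (2*n) + f (Suc (2*n))) sums S" if "f sums S" for f :: "nat \<Rightarrow> real" and S
    using sums_group[OF that, of 2] by (simp add: sum.nat_group[symmetric] mult.commute numeral_2_eq_2)
  have e1: "zeta3 = (- Polygamma 2 (1/2) / 2 + zeta3) / 8"
  proof -
    have "(\<lambda>n. 1 / (real (2*n) + 1)^3 + 1 / (real (Suc (2*n)) + 1)^3) sums zeta3"
      using grp[OF z] by simp
    moreover have "(\<lambda>n. (1 / (real n + 1/2)^3 + 1 / (real n + 1)^3) / 8) sums ((- Polygamma 2 (1/2) / 2 + zeta3) / 8)"
      by (intro sums_divide sums_add h z)
    moreover have "1 / (real (2*n) + 1)^3 + 1 / (real (Suc (2*n)) + 1)^3 = (1 / (real n + 1/2)^3 + 1 / (real n + 1)^3) / 8" for n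
    proof -
      have "real (2*n) + 1 = 2 * (real n + 1/2)" "real (Suc (2*n)) + 1 = 2 * (real n + 1)" by simp_all
      then show ?thesis by (simp only: power_mult_distrib) (simp add: add_divide_distrib)
    qed
    ultimately show ?thesis by (metis (no_types, lifting) sums_cong sums_unique2)
  qed
  have e2: "- Polygamma 2 (1/2) / 2 = (- Polygamma 2 (1/4) / 2 + - Polygamma 2 (3/4) / 2) / (8::real)"
  proof -
    have "(\<lambda>n. 1 / (real (2*n) + 1/2)^3 + 1 / (real (Suc (2*n)) + 1/2)^3) sums (- Polygamma 2 (1/2) / 2)"
      using grp[OF h] by simp
    moreover have "(\<lambda>n. (1 / (real n + 1/4)^3 + 1 / (real n + 3/4)^3) / 8) sums ((- Polygamma 2 (1/4) / 2 + - Polygamma 2 (3/4) / 2) / 8)"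
      by (intro sums_divide sums_add q1 q3)
    moreover have "1 / (real (2*n) + 1/2)^3 + 1 / (real (Suc (2*n)) + 1/2)^3 = (1 / (real n + 1/4)^3 + 1 / (real n + 3/4)^3) / 8" for n
    proof -
      have "real (2*n) + 1/2 = 2 * (real n + 1/4)" "real (Suc (2*n)) + 1/2 = 2 * (real n + 3/4)" by simp_all
      then show ?thesis by (simp only: power_mult_distrib) (simp add: add_divide_distrib)
    qed
    ultimately show ?thesis by (metis (no_types, lifting) sums_cong sums_unique2)
  qed
  have refl: "Polygamma 2 (3/4) - Polygamma 2 (1/4) = (4 * pi^3 :: real)"
  proof -
    have "Polygamma 2 (1 - 1/4) - Polygamma 2 (1/4) = 2 * pi^3 * cos (pi * (1/4)) / sin (pi * (1/4 :: real))^3"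
      by (rule Polygamma_2_reflection_real) auto
    then show ?thesis by (simp add: cos_45 sin_45 power3_eq_cube field_simps)
  qed
  have "- Polygamma 2 (3/4) / 2 = 28 * zeta3 - pi^3" using e1 e2 refl by (simp add: field_simps)
  then show ?thesis using q3 by simp
qed

subsection \<open>The undeformed sum\<close>

definition gosper_weight :: "real \<Rightarrow> nat \<Rightarrow> real" where
  "gosper_weight c k =
     pochhammer (1/2) k ^ 3 * pochhammer c k / (fact k ^ 3 * pochhammer (3/2 - 2*c) k * 4^k)"

definition gosper_term :: "real \<Rightarrow> nat \<Rightarrow> real" where
  "gosper_term c k = (6 * real k + 1) * gosper_weight c k"

text \<open>WZ certificate for the step from \<open>c\<close> to \<open>c - 1\<close>, already
  multiplied by the weight at \<open>c - 1\<close>. The factor \<open>real k ^ 3\<close> makes it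
  vanish at 0.\<close>

definition gosper_cert :: "real \<Rightarrow> nat \<Rightarrow> real" where
  "gosper_cert c k = - 8 * real k ^ 3 * (5/2 - 2*c + real k) * gosper_weight (c-1) k
      / ((c-1) * (3/2 - 2*c) * (5/2 - 2*c))"

lemma gosper_weight_Suc:
  "gosper_weight c (Suc k) = gosper_weight c k *
     ((real k + 1/2)^3 * (c + real k) / (4 * (real k + 1)^3 * (3/2 - 2*c + real k)))"
  by (simp add: gosper_weight_def pochhammer_Suc power_mult_distrib add.commute mult_ac)

lemma gosper_weight_shift:
  assumes c: "c \<le> 1/4"
  shows "gosper_weight c k * ((c-1) * (3/2 - 2*c) * (5/2 - 2*c)) =
    gosper_weight (c-1) k * ((c - 1 + real k) * (3/2 - 2*c + real k) * (5/2 - 2*c + real k))"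
proof -
  have "(c-1) * pochhammer c k = pochhammer (c-1) k * (c - 1 + real k)"
    using pochhammer_rec[of "c-1" k] pochhammer_Suc[of "c-1" k] by simp
  moreover have "(3/2 - 2*c) * (5/2 - 2*c) * pochhammer (3/2 - 2*(c-1)) k
      = pochhammer (3/2 - 2*c) k * (3/2 - 2*c + real k) * (5/2 - 2*c + real k)"
  proof -
    have "x * ((x + 1) * pochhammer (x + 1 + 1) k) = pochhammer x k * (x + real k) * (x + real (Suc k))" for x :: real
      by (simp only: pochhammer_rec[symmetric] pochhammer_Suc[symmetric])
    from this[of "3/2 - 2*c"] show ?thesis by (simp add: algebra_simps add_divide_distrib diff_divide_distrib)
  qed
  moreover have "pochhammer (3/2 - 2*c) k > 0" "pochhammer (3/2 - 2*(c-1)) k > 0"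
    using c by (auto intro!: pochhammer_pos)
  moreover have "P * p / (f * q * e) * (x * y * z) = P * p' / (f * q' * e) * (u * v * w)"
    if "x * p = p' * u" "y * z * q' = q * v * w" "q > 0" "q' > 0" "f > 0" "e > 0"
    for P p f q e x y z p' q' u v w :: real
  proof -
    have "(x * p) * (y * z * q') = (p' * u) * (q * v * w)" using that(1,2) by simp
    then show ?thesis using that(3-) by (simp add: divide_simps mult_ac)
  qed
  ultimately show ?thesis
    unfolding gosper_weight_def by simp
qed

lemma gosper_partial_sum_recursion:
  assumes c: "c \<le> 1/4"
  shows "(\<Sum>k<N. gosper_term c k) =
    (1-c)^2 / ((3/4-c) * (5/4-c)) * (\<Sum>k<N. gosper_term (c-1) k) + gosper_cert c N"
proof (induction N)
  case 0
  then show ?case by (simp add: gosper_cert_def)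
next
  case (Suc N)
  define k where "k = real N"
  define W where "W = gosper_weight (c-1) N"
  define M where "M = (c-1) * (3/2 - 2*c) * (5/2 - 2*c)"
  have M: "M \<noteq> 0" using c by (auto simp: M_def)
  have kpos: "k \<ge> 0" by (simp add: k_def)
  have w: "gosper_weight c N = W * ((c - 1 + k) * (3/2 - 2*c + k) * (5/2 - 2*c + k)) / M"
    using gosper_weight_shift[OF c, of N] M
    unfolding M_def[symmetric] W_def k_def by (simp add: eq_divide_eq)
  have s: "(1-c)^2 / ((3/4-c) * (5/4-c)) = 4 * (c-1)^3 / M"
    using c by (simp add: M_def divide_simps) algebra
  \<comment> \<open>The prefactor of the certificate at \<open>Suc N\<close> cancels exactly the
    denominator of the weight quotient.\<close>
  have wS: "(k+1)^3 * (7/2 - 2*c + k) * gosper_weight (c-1) (Suc N) = W * ((k + 1/2)^3 * (c - 1 + k) / 4)"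
  proof -
    have "A * B * (W * (C / (4 * A * B))) = W * (C / 4)" if "A > 0" "B > 0" for A B C :: real
      using that by simp
    from this[of "(k+1)^3" "7/2 - 2*c + k" "(k + 1/2)^3 * (c - 1 + k)"] show ?thesis
      unfolding gosper_weight_Suc W_def k_def[symmetric] using c kpos by (simp add: algebra_simps)
  qed
  have cS: "gosper_cert c (Suc N) = - 8 * (W * ((k + 1/2)^3 * (c - 1 + k) / 4)) / M"
  proof -
    have "gosper_cert c (Suc N) = - 8 * ((k+1)^3 * (7/2 - 2*c + k) * gosper_weight (c-1) (Suc N)) / M"
      by (simp add: gosper_cert_def M_def k_def algebra_simps)
    then show ?thesis unfolding wS .
  qed
  have cN: "gosper_cert c N = - 8 * (k^3 * (5/2 - 2*c + k) * W) / M"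
    by (simp add: gosper_cert_def M_def k_def W_def)
  have "gosper_term c N - 4 * (c-1)^3 / M * gosper_term (c-1) N = gosper_cert c (Suc N) - gosper_cert c N"
  proof -
    \<comment> \<open>With \<open>M\<close> cleared and \<open>W\<close> a common factor, the WZ
      relation is a polynomial identity in \<open>c\<close> and \<open>k\<close>.\<close>
    have "(6*k+1) * (W * ((c - 1 + k) * (3/2 - 2*c + k) * (5/2 - 2*c + k))) - 4 * (c-1)^3 * ((6*k+1) * W)
      = - 8 * (W * ((k + 1/2)^3 * (c - 1 + k) / 4)) - - 8 * (k^3 * (5/2 - 2*c + k) * W)"
      by (simp add: power3_eq_cube algebra_simps add_divide_distrib diff_divide_distrib)
    then have "((6*k+1) * (W * ((c - 1 + k) * (3/2 - 2*c + k) * (5/2 - 2*c + k))) - 4 * (c-1)^3 * ((6*k+1) * W)) / M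
      = (- 8 * (W * ((k + 1/2)^3 * (c - 1 + k) / 4)) - - 8 * (k^3 * (5/2 - 2*c + k) * W)) / M"
      by simp
    then show ?thesis
      unfolding cS cN gosper_term_def w k_def[symmetric] W_def[symmetric]
      by (simp only: diff_divide_distrib) simp
  qed
  with Suc show ?case unfolding s by (simp add: algebra_simps add_divide_distrib)
qed

section \<open>Bounds uniform in \<open>c\<close>, convergence and iteration\<close>

lemma gosper_weight_bound:
  assumes c: "c \<le> 1/4"
  shows "\<bar>gosper_weight c k\<bar> \<le> (1/4)^k"
proof (induction k)
  case 0
  then show ?case by (simp add: gosper_weight_def)
next
  case (Suc k)
  have 1: "(real k + 1/2)^3 \<le> (real k + 1)^3" by (rule power_mono) auto
  \<comment> \<open>Hence consecutive weights have quotient at most 1/4 in modulus for every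
    \<open>c \<le> 1/4\<close>. The majorant is free of \<open>c\<close>, as the limit along
    \<open>c - n\<close> requires.\<close>
  have 2: "\<bar>c + real k\<bar> \<le> 3/2 - 2*c + real k" using c by (simp add: abs_le_iff)
  have "\<bar>(real k + 1/2)^3 * (c + real k) / (4 * (real k + 1)^3 * (3/2 - 2*c + real k))\<bar>
      = ((real k + 1/2)^3 * \<bar>c + real k\<bar>) / (4 * ((real k + 1)^3 * (3/2 - 2*c + real k)))"
    using c by (simp add: abs_mult)
  also have "\<dots> \<le> ((real k + 1)^3 * (3/2 - 2*c + real k)) / (4 * ((real k + 1)^3 * (3/2 - 2*c + real k)))"
    using c by (intro divide_right_mono mult_mono 1 2) auto
  also have "\<dots> = 1/4" using c by simp
  finally have "\<bar>gosper_weight c k\<bar> * \<bar>(real k + 1/2)^3 * (c + real k) / (4 * (real k + 1)^3 * (3/2 - 2*c + real k))\<bar>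
     \<le> (1/4)^k * (1/4)"
    by (intro mult_mono Suc) auto
  then show ?case unfolding gosper_weight_Suc by (simp add: abs_mult)
qed

lemma gosper_bound_summable: "summable (\<lambda>k. (6 * real k + 1) * (1/4)^k)"
proof (rule summable_comparison_test_bigo)
  show "summable (\<lambda>k. norm ((1/2 :: real) ^ k))" by simp
  show "(\<lambda>k. (6 * real k + 1) * (1/4)^k) \<in> O(\<lambda>k. (1/2)^k)" by real_asymp
qed

lemma gosper_term_bound:
  assumes "c \<le> 1/4"
  shows "\<bar>gosper_term c k\<bar> \<le> (6 * real k + 1) * (1/4)^k"
  unfolding gosper_term_def abs_mult using gosper_weight_bound[OF assms, of k]
  by (intro mult_mono) auto

lemma gosper_summable:
  assumes "c \<le> 1/4"
  shows "summable (gosper_term c)"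
  by (rule summable_comparison_test'[OF gosper_bound_summable])
    (use gosper_term_bound[OF assms] in simp)

lemma gosper_cert_tendsto:
  assumes c: "c \<le> 1/4"
  shows "gosper_cert c \<longlonglongrightarrow> 0"
proof -
  define M where "M = (c-1) * (3/2 - 2*c) * (5/2 - 2*c)"
  show ?thesis
  proof (rule Lim_null_comparison)
    show "(\<lambda>k. 8 * real k ^ 3 * (5/2 - 2*c + real k) / \<bar>M\<bar> * (1/4)^k) \<longlonglongrightarrow> 0"
    proof -
      have "(\<lambda>k. 8 * real k ^ 3 * (5/2 - 2*c + real k) * (1/4)^k) \<longlonglongrightarrow> 0" by real_asymp
      from tendsto_divide_zero[OF this, of "\<bar>M\<bar>"] show ?thesis by simp
    qed
    show "\<forall>\<^sub>F k in sequentially. norm (gosper_cert c k) \<le> 8 * real k ^ 3 * (5/2 - 2*c + real k) / \<bar>M\<bar> * (1/4)^k"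
    proof (intro always_eventually allI)
      fix k
      have "norm (gosper_cert c k) = 8 * real k ^ 3 * (5/2 - 2*c + real k) / \<bar>M\<bar> * \<bar>gosper_weight (c-1) k\<bar>"
        using c by (simp add: gosper_cert_def M_def abs_mult)
      also have "\<dots> \<le> 8 * real k ^ 3 * (5/2 - 2*c + real k) / \<bar>M\<bar> * (1/4)^k"
        using c by (intro mult_left_mono gosper_weight_bound) auto
      finally show "norm (gosper_cert c k) \<le> \<dots>" .
    qed
  qed
qed

lemma gosper_suminf_recursion:
  assumes c: "c \<le> 1/4"
  shows "suminf (gosper_term c) = (1-c)^2 / ((3/4-c) * (5/4-c)) * suminf (gosper_term (c-1))"
proof -
  have "(\<lambda>N. \<Sum>k<N. gosper_term c k) \<longlonglongrightarrow> suminf (gosper_term c)"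
    using gosper_summable[OF c] by (rule summable_LIMSEQ)
  moreover have "(\<lambda>N. \<Sum>k<N. gosper_term c k) \<longlonglongrightarrow> (1-c)^2 / ((3/4-c) * (5/4-c)) * suminf (gosper_term (c-1)) + 0"
    unfolding gosper_partial_sum_recursion[OF c]
    by (intro tendsto_add tendsto_mult tendsto_const gosper_cert_tendsto summable_LIMSEQ gosper_summable c)
      (use c in simp)
  ultimately show ?thesis using LIMSEQ_unique by fastforce
qed

lemma gosper_suminf_iterate:
  assumes c: "c \<le> 1/4"
  shows "suminf (gosper_term c) =
    pochhammer (1-c) n ^ 2 / (pochhammer (3/4-c) n * pochhammer (5/4-c) n) * suminf (gosper_term (c - real n))"
proof (induction n)
  case 0
  then show ?case by simp
next
  case (Suc n)
  have "suminf (gosper_term (c - real n)) =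
     (1-c+real n)^2 / ((3/4-c+real n) * (5/4-c+real n)) * suminf (gosper_term (c - real (Suc n)))"
    using gosper_suminf_recursion[of "c - real n"] c by (simp add: algebra_simps)
  then show ?case unfolding Suc by (simp add: pochhammer_Suc power_mult_distrib mult_ac)
qed

section \<open>The limit along \<open>c - n\<close> and the resulting Gamma quotient\<close>

lemma pochhammer_quotient_tendsto:
  fixes x y u :: real
  assumes pos: "x > 0" "y > 0" "u > 0" and eq: "x + y = 2 * u"
  shows "(\<lambda>n. pochhammer u n ^ 2 / (pochhammer x n * pochhammer y n)) \<longlonglongrightarrow> Gamma x * Gamma y / Gamma u ^ 2"
proof (rule Lim_transform_eventually)
  have "Gamma u \<noteq> 0" using Gamma_real_pos[OF pos(3)] by simp
  then show "(\<lambda>n. Gamma_series' x n * Gamma_series' y n / Gamma_series' u n ^ 2) \<longlonglongrightarrow> Gamma x * Gamma y / Gamma u ^ 2"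
    by (intro tendsto_intros Gamma_series'_LIMSEQ) simp
  show "\<forall>\<^sub>F n in sequentially. Gamma_series' x n * Gamma_series' y n / Gamma_series' u n ^ 2
      = pochhammer u n ^ 2 / (pochhammer x n * pochhammer y n)"
    using eventually_gt_at_top[of 0]
  proof eventually_elim
    case (elim n)
    \<comment> \<open>Each \<open>Gamma_series'\<close> carries a power of \<open>n\<close>; by
      \<open>x + y = 2 * u\<close> these cancel, and so do the factorials.\<close>
    have "exp (x * ln (real n)) * exp (y * ln (real n)) = exp (u * ln (real n)) ^ 2"
      unfolding exp_add[symmetric] exp_of_nat_mult[symmetric] using eq by (simp flip: distrib_right)
    moreover have "F * X / p * (F * Y / q) / (F * U / r)^2 = r^2 / (p * q)"
      if "X * Y = U^2" "U > 0" "F > 0" for F X Y U p q r :: real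
      using that by (simp add: power2_eq_square divide_simps)
    ultimately show ?case unfolding Gamma_series'_def by simp
  qed
qed

text \<open>Only the quotient of \<open>c - n + k\<close> by \<open>3/2 - 2*(c - n) + k\<close>
  depends on \<open>n\<close>. It tends to \<open>-1/2\<close>, which with the factor 1/4 gives
  \<open>-1/8\<close>, and \<open>c\<close> disappears.\<close>

lemma gosper_term_tendsto:
  "(\<lambda>n. gosper_term (c - real n) k) \<longlonglongrightarrow>
     (6 * real k + 1) * (pochhammer (1/2) k ^ 3 / fact k ^ 3 * (-1/8) ^ k)"
  unfolding gosper_term_def
proof (intro tendsto_mult tendsto_const, induction k)
  case 0
  then show ?case by (simp add: gosper_weight_def)
next
  case (Suc k)
  have "(\<lambda>n. (real k + 1/2)^3 * (c - real n + real k) / (4 * (real k + 1)^3 * (3/2 - 2*(c - real n) + real k)))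
     \<longlonglongrightarrow> (real k + 1/2)^3 / (real k + 1)^3 * (-1/8)"
  proof -
    have "(\<lambda>n. (c - real n + real k) / (3/2 - 2*(c - real n) + real k)) \<longlonglongrightarrow> -1/2"
      by real_asymp
    from tendsto_mult[OF tendsto_const[of "(real k + 1/2)^3 / (4 * (real k + 1)^3)"] this]
    show ?thesis by (simp add: mult_ac)
  qed
  from tendsto_mult[OF Suc this] show ?case
    unfolding gosper_weight_Suc
    by (simp add: pochhammer_Suc power_mult_distrib add.commute mult_ac)
qed

lemma gosper_suminf_tendsto:
  assumes c: "c \<le> 1/4"
  shows "(\<lambda>n. suminf (gosper_term (c - real n))) \<longlonglongrightarrow>
     (\<Sum>k. (6 * real k + 1) * (pochhammer (1/2) k ^ 3 / fact k ^ 3 * (-1/8) ^ k))"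
proof -
  have "\<bar>gosper_term (c - real n) k\<bar> \<le> (6 * real k + 1) * (1/4)^k" for n k
    by (rule gosper_term_bound) (use c in simp)
  then show ?thesis
    using tannerys_theorem[where a = "\<lambda>k n. gosper_term (c - real n) k", OF gosper_term_tendsto _ gosper_bound_summable]
    by (simp add: case_prod_unfold)
qed

text \<open>The iterated recurrence is constant in \<open>n\<close>, so its value equals the product
  of the limits of the Pochhammer quotient and of the shifted sums.\<close>

lemma gosper_suminf_eq:
  assumes c: "c \<le> 1/4"
  shows "suminf (gosper_term c) = Gamma (3/4-c) * Gamma (5/4-c) / Gamma (1-c) ^ 2 *
     (\<Sum>k. (6 * real k + 1) * (pochhammer (1/2) k ^ 3 / fact k ^ 3 * (-1/8) ^ k))" (is "_ = ?r")
proof -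
  have "(\<lambda>n. pochhammer (1-c) n ^ 2 / (pochhammer (3/4-c) n * pochhammer (5/4-c) n) * suminf (gosper_term (c - real n)))
     \<longlonglongrightarrow> ?r"
    using c by (intro tendsto_mult pochhammer_quotient_tendsto gosper_suminf_tendsto) auto
  then have "(\<lambda>n. suminf (gosper_term c)) \<longlonglongrightarrow> ?r"
    unfolding gosper_suminf_iterate[OF c, symmetric] .
  then show ?thesis by (simp add: LIMSEQ_const_iff)
qed

text \<open>The limit series \<open>L\<close> is obtained from \<open>c = 0\<close>, where
  \<open>pochhammer 0 k\<close> leaves only the term 1. This gives
  \<open>L = 4 / (pi * sqrt 2)\<close>, a Ramanujan-type series for \<open>1/pi\<close>, which is
  then inserted at \<open>c = 1/4\<close>.\<close>

lemma gosper_suminf_quarter: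
  "suminf (gosper_term (1/4)) = sqrt 2 * Gamma (1/4) ^ 2 / pi powr (5/2)"
proof -
  define L :: real where "L = (\<Sum>k. (6 * real k + 1) * (pochhammer (1/2) k ^ 3 / fact k ^ 3 * (-1/8) ^ k))"
  define G where "G = Gamma (1/4 :: real)"
  have G: "G > 0" unfolding G_def by (rule Gamma_real_pos) simp
  have G34: "Gamma (3/4 :: real) = pi * sqrt 2 / G"
  proof -
    have "pi / (sqrt 2 / 2) = pi * sqrt 2" by (simp add: field_simps)
    then show ?thesis
      using Gamma_reflection_real[of "1/4"] G
      by (simp add: sin_45 nonzero_eq_divide_eq mult.commute flip: G_def)
  qed
  have G54: "Gamma (5/4 :: real) = G / 4"
  proof -
    have "(1/4 :: real) \<notin> \<int>\<^sub>\<le>\<^sub>0" by (auto elim!: nonpos_Ints_cases)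
    from Gamma_plus1[OF this] show ?thesis by (simp add: G_def)
  qed
  have "suminf (gosper_term 0) = 1"
  proof -
    have "suminf (gosper_term 0) = (\<Sum>k\<in>{0}. gosper_term 0 k)"
      by (rule suminf_finite) (auto simp: gosper_term_def gosper_weight_def pochhammer_0_left)
    then show ?thesis by (simp add: gosper_term_def gosper_weight_def)
  qed
  then have 1: "1 = Gamma (3/4) * Gamma (5/4) * L"
    using gosper_suminf_eq[of 0] by (simp add: L_def)
  have "suminf (gosper_term (1/4)) = sqrt pi / Gamma (3/4)^2 * L"
    using gosper_suminf_eq[of "1/4"] by (simp add: L_def Gamma_one_half_real)
  also have "L = 4 / (pi * sqrt 2)" using 1 G unfolding G34 G54 by (simp add: field_simps)
  also have "sqrt pi / Gamma (3/4)^2 * (4 / (pi * sqrt 2)) = sqrt 2 * G^2 / (pi powr (5/2))"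
  proof -
    have p: "pi powr (5/2) = pi^2 * sqrt pi"
      using powr_add[of pi 2 "1/2"] by (simp add: powr_half_sqrt)
    \<comment> \<open>For \<open>x = sqrt pi\<close>, \<open>y = sqrt 2\<close>,
      \<open>z = pi\<close>: the identity left after clearing denominators.\<close>
    have "x * (4 * x) = y * (y * (y * (z * y)))" if "x * x = z" "y * y = 2" for x y z :: real
    proof -
      have "x * (4 * x) = 4 * (x * x)" by simp
      also have "\<dots> = (y * y) * (y * y) * z" unfolding that by simp
      finally show ?thesis by simp
    qed
    then show ?thesis unfolding G34 p using G
      by (simp add: power2_eq_square divide_simps)
  qed
  finally show ?thesis by (simp add: G_def)
qed

subsection \<open>The derivative sum\<close>

lemma weight_pos: "weight n 0 k > 0"
  unfolding weight_def using upper_pos[of 0 n] lower_pos[of 0 n]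
  by (auto intro!: mult_pos_pos divide_pos_pos pochhammer_pos prod_pos)

lemma linfac_pos: "linfac n k > 0"
  by (simp add: linfac_def add_pos_nonneg add_nonneg_pos)

lemma harm_sum_nonneg: "harm_sum n k \<ge> 0"
  unfolding harm_sum_def by (intro sum_nonneg) auto

text \<open>A crude bound valid for all \<open>n\<close>, sufficient for convergence: the two parts
  of a summand are at most 8 and 1.\<close>

lemma harm_sum_le: "harm_sum n k \<le> 9 * real k"
proof -
  have "1 / (2 * real n + real j + 1/2)^3 + 1 / (8 * (2 * real n + real j + 1)^3) \<le> 9" for j
  proof -
    have "1 / (2 * real n + real j + 1/2)^3 \<le> 1 / (1/2)^3"
      by (intro divide_left_mono power_mono mult_pos_pos) auto
    also have "\<dots> = 8" by (simp add: power3_eq_cube)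
    finally have "1 / (2 * real n + real j + 1/2)^3 \<le> 8" .
    moreover have "1 / (8 * (2 * real n + real j + 1)^3) \<le> 1 / 1"
    proof (intro divide_left_mono)
      have "1 \<le> (2 * real n + real j + 1)^3" by (rule one_le_power) simp
      then show "1 \<le> 8 * (2 * real n + real j + 1)^3" by linarith
    qed auto
    ultimately show ?thesis by linarith
  qed
  then have "harm_sum n k \<le> (\<Sum>j<k. 9)" unfolding harm_sum_def by (intro sum_mono)
  then show ?thesis by simp
qed

text \<open>The decay in \<open>n\<close>: with \<open>x = 2n + k\<close> each summand is at most
  \<open>2 / (x * (x+1))\<close>, which telescopes.\<close>

lemma harm_sum_le_inverse:
  assumes n: "n > 0"
  shows "harm_sum n k \<le> 1 / real n"
proof -
  have "harm_sum n k \<le> 2 * (1 / (2 * real n) - 1 / (2 * real n + real k))"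
  proof (induction k)
    case 0
    then show ?case by (simp add: harm_sum_def)
  next
    case (Suc k)
    define x where "x = 2 * real n + real k"
    have x: "x \<ge> 2" using n by (simp add: x_def)
    have "x * (x+1) \<le> (x + 1/2)^2" by (simp add: power2_eq_square algebra_simps)
    also have "\<dots> \<le> (x + 1/2)^3" using x by (intro power_increasing) auto
    finally have "1 / (x + 1/2)^3 \<le> 1 / (x * (x+1))"
      using x by (intro divide_left_mono mult_pos_pos zero_less_power) auto
    moreover have "x * (x+1) \<le> 8 * (x+1)^3"
    proof -
      have "x * (x+1) \<le> (x+1)^2" using x by (simp add: power2_eq_square)
      also have "\<dots> \<le> (x+1)^3" using x by (intro power_increasing) auto
      also have "\<dots> \<le> 8 * (x+1)^3" using x by simp
      finally show ?thesis .
    qed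
    then have "1 / (8 * (x + 1)^3) \<le> 1 / (x * (x+1))"
      using x by (intro divide_left_mono mult_pos_pos zero_less_power) auto
    moreover have "1 / (x * (x+1)) = 1 / x - 1 / (x+1)"
      using x by (simp add: field_simps)
    ultimately show ?case
      using Suc by (simp add: harm_sum_def x_def add_ac)
  qed
  also have "\<dots> \<le> 2 * (1 / (2 * real n))" by (intro mult_left_mono) auto
  finally show ?thesis by simp
qed

text \<open>The cubic product is at most 1; what remains passes the ratio test with limit 1/4.
  Arbitrary powers are allowed because the certificate grows polynomially in
  \<open>k\<close>.\<close>

lemma weight_power_summable: "summable (\<lambda>k. weight n 0 k * real k ^ p)"
proof -
  define b where "b k = pochhammer (3 * real n + 1/4) k / (fact k * 4^k) * real k ^ p" for k
  have bpos: "b k \<ge> 0" for k by (auto simp: b_def intro!: mult_nonneg_nonneg divide_nonneg_nonneg pochhammer_nonneg)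
  have "(\<lambda>k. (3 * real n + 1/4 + real k) / (4 * (real k + 1)) * ((real k + 1) / real k) ^ p) \<longlonglongrightarrow> 1/4 * 1 ^ p"
    by (intro tendsto_mult tendsto_power) real_asymp+
  then have "\<forall>\<^sub>F k in sequentially. (3 * real n + 1/4 + real k) / (4 * (real k + 1)) * ((real k + 1) / real k) ^ p < 1/2"
    by (rule order_tendstoD(2)) simp
  then have "\<forall>\<^sub>F k in sequentially. b (Suc k) \<le> 1/2 * b k"
    using eventually_gt_at_top[of 0]
  proof eventually_elim
    case (elim k)
    have "b (Suc k) = (3 * real n + 1/4 + real k) / (4 * (real k + 1)) * ((real k + 1) / real k) ^ p * b k"
      using elim(2) by (simp add: b_def pochhammer_Suc power_divide add_ac mult_ac)
    also have "\<dots> \<le> 1/2 * b k"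
      using elim(1) by (intro mult_right_mono bpos) simp
    finally show ?case .
  qed
  then obtain N where "b (Suc k) \<le> 1/2 * b k" if "k \<ge> N" for k
    unfolding eventually_at_top_linorder by blast
  then have sb: "summable b"
    by (intro summable_ratio_test[of "1/2" N]) (use bpos in auto)
  have le: "norm (weight n 0 k * real k ^ p) \<le> b k" for k
  proof -
    have "(\<Prod>j<k. upper n 0 j / lower n 0 j) \<le> 1"
      using upper_pos[of 0 n] lower_pos[of 0 n]
      by (intro prod_le_1) (auto simp: upper_def lower_def intro!: divide_nonneg_nonneg power_mono)
    then have "weight n 0 k \<le> pochhammer (3 * real n + 1/4) k / (fact k * 4^k)"
      unfolding weight_def by (intro mult_left_le) (auto intro!: divide_nonneg_nonneg pochhammer_nonneg)
    then have "weight n 0 k * real k ^ p \<le> b k"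
      unfolding b_def by (rule mult_right_mono) simp
    then show ?thesis
      using weight_pos[of n k] by (simp add: abs_mult)
  qed
  show ?thesis
    by (rule summable_comparison_test'[where g = b and N = 0, OF sb le])
qed

lemma linfac_weight_summable: "summable (\<lambda>k. linfac n k * weight n 0 k)"
  using summable_add[OF summable_mult[OF weight_power_summable[of n 1], of 3]
    summable_mult[OF weight_power_summable[of n 0], of "6 * real n + 1/2"]]
  by (simp add: linfac_def algebra_simps)

lemma linfac_weight_harm_summable: "summable (\<lambda>k. linfac n k * weight n 0 k * harm_sum n k)"
proof (rule summable_comparison_test')
  show "summable (\<lambda>k. 27 * (weight n 0 k * real k ^ 2) + 9 * (6 * real n + 1/2) * (weight n 0 k * real k ^ 1))"
    by (intro summable_add summable_mult weight_power_summable)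
  show "norm (linfac n k * weight n 0 k * harm_sum n k) \<le>
     27 * (weight n 0 k * real k ^ 2) + 9 * (6 * real n + 1/2) * (weight n 0 k * real k ^ 1)" for k
  proof -
    have "norm (linfac n k * weight n 0 k * harm_sum n k) = linfac n k * weight n 0 k * harm_sum n k"
      using weight_pos[of n k] linfac_pos[of n k] harm_sum_nonneg[of n k] by (simp add: abs_mult)
    also have "\<dots> \<le> linfac n k * weight n 0 k * (9 * real k)"
      using weight_pos[of n k] linfac_pos[of n k] by (intro mult_left_mono harm_sum_le) auto
    also have "\<dots> = 27 * (weight n 0 k * real k ^ 2) + 9 * (6 * real n + 1/2) * (weight n 0 k * real k ^ 1)"
      by (simp add: linfac_def power2_eq_square algebra_simps)
    finally show ?thesis .
  qed
qed

section \<open>Differentiating the recursion at \<open>u = 0\<close>\<close>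

definition cert_poly_deriv :: "real \<Rightarrow> real \<Rightarrow> real" where
  "cert_poly_deriv k y = k * (27*y^2 + 9*y) - k^2 * (6*y + 1) - 43*y^3 - 27*y^2 - 3*y + 1"

text \<open>Derivative of the certificate written with denominator \<open>(M + u) * (D - u)\<close>,
  where \<open>M = upper n 0 0\<close> and \<open>D = 8 * lower n 0 k\<close>.\<close>

definition cert_deriv :: "nat \<Rightarrow> nat \<Rightarrow> real" where
  "cert_deriv n k = real k *
     (let y = 2 * real n + real k + 1/2; M = (2 * real n + 1/2)^3; D = (2*y + 1)^3 in
       cert_poly_deriv (real k) y / (M * D) - cert_poly (real k) y 0 / (M^2 * D) + cert_poly (real k) y 0 / (M * D^2))"

lemma cert_has_deriv: "((\<lambda>u. cert n u k) has_real_derivative cert_deriv n k) (at 0)"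
proof -
  define y where "y = 2 * real n + real k + 1/2"
  define M where "M = (2 * real n + 1/2)^3"
  define D where "D = (2*y + 1)^3"
  have pos: "M > 0" "D > 0" by (auto simp: M_def D_def y_def intro!: add_nonneg_pos)
  define a where "a = cert_poly_deriv (real k) y"
  define b where "b = cert_poly (real k) y 0"
  \<comment> \<open>The certificate polynomial is quadratic in \<open>u\<close>;
    \<open>cert_poly_deriv\<close> is its linear coefficient.\<close>
  have "cert_poly (real k) y = (\<lambda>u. b + u * a + u^2)"
    unfolding a_def b_def cert_poly_def cert_poly_deriv_def fun_eq_iff by (simp add: algebra_simps)
  moreover have "((\<lambda>u. b + u * a + u^2) has_real_derivative a) (at 0)"
    by (auto intro!: derivative_eq_intros)
  ultimately have p: "((\<lambda>u. cert_poly (real k) y u) has_real_derivative a) (at 0)"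
    by (simp only:)
  have q: "((\<lambda>u. (M + u) * (D - u)) has_real_derivative D - M) (at 0)"
    by (auto intro!: derivative_eq_intros)
  have cd: "cert_deriv n k = real k * (a / (M * D) - b / (M^2 * D) + b / (M * D^2))"
    unfolding cert_deriv_def Let_def a_def b_def M_def D_def y_def ..
  have "(a * (M * D) - b * (D - M)) / (M * D * (M * D)) = a / (M * D) - b / (M^2 * D) + b / (M * D^2)"
    using pos by (simp add: power2_eq_square divide_simps) (simp add: algebra_simps)
  with DERIV_cmult[OF DERIV_divide[OF p q], of "real k"] pos
  have "((\<lambda>u. real k * (cert_poly (real k) y u / ((M + u) * (D - u)))) has_real_derivative cert_deriv n k) (at 0)"
    unfolding cd by (simp flip: b_def)
  moreover have "cert n u k = real k * (cert_poly (real k) y u / ((M + u) * (D - u)))" for u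
  proof -
    have "8 * lower n u k = D - u"
      by (simp add: lower_def D_def y_def power3_eq_cube algebra_simps)
    moreover have "upper n u 0 = M + u" by (simp add: upper_def M_def)
    moreover have "8 * upper n u 0 * lower n u k = upper n u 0 * (8 * lower n u k)" by simp
    ultimately show ?thesis by (simp only: cert_def y_def times_divide_eq_right)
  qed
  ultimately show ?thesis by simp
qed

definition ratio_log_deriv :: "nat \<Rightarrow> real" where
  "ratio_log_deriv n = (1 / (real n + 3/4)^3 + 1 / (2 * real n + 1)^3 + 1 / (2 * real n + 2)^3) / 8"

lemma ratio_has_deriv: "((\<lambda>u. ratio n u) has_real_derivative ratio n 0 * ratio_log_deriv n) (at 0)"
proof -
  have "((\<lambda>u. P * (a + u/8) / ((b - u/8) * (c - u/8))) has_real_derivative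
      P * (a + 0/8) / ((b - 0/8) * (c - 0/8)) * ((1/a + 1/b + 1/c) / 8)) (at 0)"
    if "a > 0" "b > 0" "c > 0" for P a b c :: real
  proof (rule DERIV_cong[OF DERIV_divide])
    show "((\<lambda>u. P * (a + u/8)) has_real_derivative P / 8) (at 0)"
      by (auto intro!: derivative_eq_intros)
    show "((\<lambda>u. (b - u/8) * (c - u/8)) has_real_derivative - (b + c) / 8) (at 0)"
      by (auto intro!: derivative_eq_intros simp: add_divide_distrib)
    show "(b - 0/8) * (c - 0/8) \<noteq> 0" using that by simp
    have "(P / 8 * (b * c) - P * a * (- (b + c) / 8)) / (b * c * (b * c)) = P * a / (b * c) * ((1/a + 1/b + 1/c) / 8)"
      using that by (simp add: divide_simps) (simp add: algebra_simps)
    then show "(P / 8 * ((b - 0/8) * (c - 0/8)) - P * (a + 0/8) * (- (b + c) / 8)) / ((b - 0/8) * (c - 0/8) * ((b - 0/8) * (c - 0/8)))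
      = P * (a + 0/8) / ((b - 0/8) * (c - 0/8)) * ((1/a + 1/b + 1/c) / 8)"
      by simp
  qed
  from this[of "(real n + 3/4)^3" "(2 * real n + 1)^3" "(2 * real n + 2)^3" "pochhammer (3 * real n + 1/4) 3"]
  show ?thesis
    unfolding ratio_def ratio_log_deriv_def lower_def by (simp add: add_nonneg_pos add_ac)
qed

lemma ratio_pos: "ratio n 0 > 0"
  unfolding ratio_def using lower_pos[of 0 n]
  by (intro divide_pos_pos mult_pos_pos pochhammer_pos) (auto simp: add_nonneg_pos)

text \<open>Both sides of \<open>partial_sum_recursion\<close> agree near \<open>u = 0\<close>, so
  their derivatives agree there. Only finite sums are differentiated, so no interchange with an
  infinite sum arises.\<close>

lemma partial_sum_deriv_recursion:
  "(\<Sum>k<N. linfac n k * weight n 0 k * harm_sum n k) =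
     ratio n 0 * ratio_log_deriv n * (\<Sum>k<N. linfac (Suc n) k * weight (Suc n) 0 k)
     + ratio n 0 * (\<Sum>k<N. linfac (Suc n) k * weight (Suc n) 0 k * harm_sum (Suc n) k)
     + (cert_deriv n N + cert n 0 N * harm_sum n N) * weight n 0 N"
proof -
  have s: "((\<lambda>u. \<Sum>k<N. linfac m k * weight m u k) has_real_derivative
      (\<Sum>k<N. linfac m k * weight m 0 k * harm_sum m k)) (at 0)" for m
    using DERIV_sum[where S = "{..<N}" and f = "\<lambda>u k. linfac m k * weight m u k", OF DERIV_cmult[OF weight_deriv]]
    by (simp add: mult.assoc)
  let ?r = "\<lambda>u. ratio n u * (\<Sum>k<N. linfac (Suc n) k * weight (Suc n) u k) + cert n u N * weight n u N"
  have 1: "(?r has_real_derivative (\<Sum>k<N. linfac n k * weight n 0 k * harm_sum n k)) (at 0)"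
  proof (rule has_field_derivative_transform_within_open[OF s[of n]])
    show "(\<Sum>k<N. linfac n k * weight n u k) = ?r u" if "u \<in> {-1/8<..<1/8}" for u
      by (rule partial_sum_recursion) (use that in auto)
  qed auto
  have 2: "(?r has_real_derivative
      (ratio n 0 * ratio_log_deriv n * (\<Sum>k<N. linfac (Suc n) k * weight (Suc n) 0 k)
       + (\<Sum>k<N. linfac (Suc n) k * weight (Suc n) 0 k * harm_sum (Suc n) k) * ratio n 0)
      + (cert_deriv n N * weight n 0 N + weight n 0 N * harm_sum n N * cert n 0 N)) (at 0)"
    by (intro DERIV_add DERIV_mult ratio_has_deriv s cert_has_deriv weight_deriv)
  from DERIV_unique[OF 1 2] show ?thesis by (simp add: algebra_simps)
qed

section \<open>Vanishing of the boundary terms\<close>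

lemma cert_poly_bigo:
  "(\<lambda>k. cert_poly (real k) (real k + a) 0) \<in> O(\<lambda>k. real k ^ 6)"
  "(\<lambda>k. cert_poly_deriv (real k) (real k + a)) \<in> O(\<lambda>k. real k ^ 6)"
  unfolding cert_poly_def cert_poly_deriv_def by real_asymp+

text \<open>Degree 6 from the polynomial and 1 from the factor \<open>real k\<close>; the
  reciprocals of \<open>D\<close> are bounded only by 1.\<close>

lemma cert_bigo: "(\<lambda>k. cert n 0 k) \<in> O(\<lambda>k. real k ^ 7)"
  and cert_deriv_bigo: "(\<lambda>k. cert_deriv n k) \<in> O(\<lambda>k. real k ^ 7)"
proof -
  define M where "M = (2 * real n + 1/2)^3"
  define a where "a = 2 * real n + 1/2"
  define D where "D k = (2 * (real k + a) + 1)^3" for k :: nat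
  define q where "q k = cert_poly (real k) (real k + a) 0" for k :: nat
  define q' where "q' k = cert_poly_deriv (real k) (real k + a)" for k :: nat
  have inv: "(\<lambda>k. 1 / D k) \<in> O(\<lambda>_. 1)"
  proof (intro bigoI[of _ 1] always_eventually allI)
    fix k
    have "D k \<ge> 1" unfolding D_def by (rule one_le_power) (simp add: a_def)
    then show "norm (1 / D k) \<le> 1 * norm (1 :: real)" by simp
  qed
  have scale: "(\<lambda>k. c * f k) \<in> O(\<lambda>k. real k ^ 7)" if "f \<in> O(\<lambda>k. real k ^ 7)" for c :: real and f
    using landau_o.big.mult[OF bigo_const[of c] that] by (simp only: mult_1)
  have y: "2 * real n + real k + 1/2 = real k + a" for k by (simp add: a_def)
  have q: "(\<lambda>k. real k * (q k * (1 / D k))) \<in> O(\<lambda>k. real k ^ 7)"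
    and q': "(\<lambda>k. real k * (q' k * (1 / D k))) \<in> O(\<lambda>k. real k ^ 7)"
    using landau_o.big.mult[OF landau_o.big_refl landau_o.big.mult[OF cert_poly_bigo(1) inv], of real a]
      landau_o.big.mult[OF landau_o.big_refl landau_o.big.mult[OF cert_poly_bigo(2) inv], of real a]
    by (simp_all add: q_def q'_def flip: power_Suc)
  have q2: "(\<lambda>k. real k * (q k * (1 / D k)) * (1 / D k)) \<in> O(\<lambda>k. real k ^ 7)"
    using landau_o.big.mult[OF q inv] by simp
  have "cert n 0 k = 1 / M * (real k * (q k * (1 / D k)))" for k
  proof -
    have "8 * upper n 0 0 * lower n 0 k = M * D k"
      by (simp add: upper_def lower_def M_def D_def a_def power3_eq_cube algebra_simps)
    then show ?thesis by (simp add: cert_def q_def y)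
  qed
  moreover have "(\<lambda>k. 1 / M * (real k * (q k * (1 / D k)))) \<in> O(\<lambda>k. real k ^ 7)"
    by (rule scale[OF q])
  ultimately show "(\<lambda>k. cert n 0 k) \<in> O(\<lambda>k. real k ^ 7)" by simp
  have "cert_deriv n k = 1 / M * (real k * (q' k * (1 / D k))) - 1 / M^2 * (real k * (q k * (1 / D k)))
      + 1 / M * (real k * (q k * (1 / D k)) * (1 / D k))" for k
    unfolding cert_deriv_def Let_def y M_def[symmetric] D_def[symmetric] q_def[symmetric] q'_def[symmetric]
    by (simp add: ring_distribs power2_eq_square)
  moreover have "(\<lambda>k. 1 / M * (real k * (q' k * (1 / D k))) - 1 / M^2 * (real k * (q k * (1 / D k)))
      + 1 / M * (real k * (q k * (1 / D k)) * (1 / D k))) \<in> O(\<lambda>k. real k ^ 7)"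
    by (rule sum_in_bigo(1)[OF sum_in_bigo(2)[OF scale[OF q'] scale[OF q]] scale[OF q2]])
  ultimately show "(\<lambda>k. cert_deriv n k) \<in> O(\<lambda>k. real k ^ 7)" by simp
qed

lemma cert_boundary_tendsto:
  "(\<lambda>N. cert n 0 N * weight n 0 N) \<longlonglongrightarrow> 0"
  "(\<lambda>N. (cert_deriv n N + cert n 0 N * harm_sum n N) * weight n 0 N) \<longlonglongrightarrow> 0"
proof -
  \<comment> \<open>The exponent 8 is 7 for the certificate plus 1 for the linear bound on
    \<open>harm_sum\<close>.\<close>
  have w: "(\<lambda>N. weight n 0 N * real N ^ 8) \<longlonglongrightarrow> 0"
    by (rule summable_LIMSEQ_zero[OF weight_power_summable])
  have key: "(\<lambda>N. f N * weight n 0 N) \<longlonglongrightarrow> 0" if f: "f \<in> O(\<lambda>N. real N ^ 8)" for f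
  proof -
    obtain c where c: "\<forall>\<^sub>F N in sequentially. norm (f N) \<le> c * norm (real N ^ 8)"
      using landau_o.bigE[OF f] by blast
    show ?thesis
    proof (rule Lim_null_comparison)
      show "(\<lambda>N. c * (weight n 0 N * real N ^ 8)) \<longlonglongrightarrow> 0"
        using tendsto_mult_right_zero[OF w] .
      show "\<forall>\<^sub>F N in sequentially. norm (f N * weight n 0 N) \<le> c * (weight n 0 N * real N ^ 8)"
        using c
      proof eventually_elim
        case (elim N)
        from mult_right_mono[OF this, of "weight n 0 N"] show ?case
          using weight_pos[of n N] by (simp add: abs_mult mult_ac)
      qed
    qed
  qed
  have up: "(\<lambda>N. real N ^ 7) \<in> O(\<lambda>N. real N ^ 8)" by real_asymp
  have h: "(\<lambda>N. harm_sum n N) \<in> O(\<lambda>N. real N)"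
    using harm_sum_le[of n] harm_sum_nonneg[of n]
    by (intro bigoI[of _ 9] always_eventually) auto
  show "(\<lambda>N. cert n 0 N * weight n 0 N) \<longlonglongrightarrow> 0"
    by (rule key, rule landau_o.big_trans[OF cert_bigo up])
  show "(\<lambda>N. (cert_deriv n N + cert n 0 N * harm_sum n N) * weight n 0 N) \<longlonglongrightarrow> 0"
  proof (rule key, rule sum_in_bigo[OF landau_o.big_trans[OF cert_deriv_bigo up]])
    show "(\<lambda>N. cert n 0 N * harm_sum n N) \<in> O(\<lambda>N. real N ^ 8)"
      using landau_o.big.mult[OF cert_bigo h] by (simp add: power_Suc2[symmetric] del: power_Suc)
  qed
qed

section \<open>Recursions for the infinite sums and the limit in \<open>n\<close>\<close>

definition base_sum :: "nat \<Rightarrow> real" where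
  "base_sum n = (\<Sum>k. linfac n k * weight n 0 k)"

definition deriv_sum :: "nat \<Rightarrow> real" where
  "deriv_sum n = (\<Sum>k. linfac n k * weight n 0 k * harm_sum n k)"

lemma base_sum_pos: "base_sum n > 0"
  unfolding base_sum_def
  by (intro suminf_pos linfac_weight_summable mult_pos_pos linfac_pos weight_pos)

lemma base_sum_recursion: "base_sum n = ratio n 0 * base_sum (Suc n)"
proof -
  have "(\<lambda>N. \<Sum>k<N. linfac n k * weight n 0 k) \<longlonglongrightarrow> ratio n 0 * base_sum (Suc n) + 0"
    unfolding partial_sum_recursion[of 0 n, simplified] base_sum_def
    by (intro tendsto_intros cert_boundary_tendsto summable_LIMSEQ linfac_weight_summable)
  from LIMSEQ_unique[OF summable_LIMSEQ[OF linfac_weight_summable] this] show ?thesis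
    unfolding base_sum_def[of n] by simp
qed

lemma deriv_sum_recursion:
  "deriv_sum n = ratio n 0 * ratio_log_deriv n * base_sum (Suc n) + ratio n 0 * deriv_sum (Suc n)"
proof -
  have "(\<lambda>N. \<Sum>k<N. linfac n k * weight n 0 k * harm_sum n k) \<longlonglongrightarrow>
      ratio n 0 * ratio_log_deriv n * base_sum (Suc n) + ratio n 0 * deriv_sum (Suc n) + 0"
    unfolding partial_sum_deriv_recursion[where n = n] base_sum_def deriv_sum_def
    by (intro tendsto_intros cert_boundary_tendsto summable_LIMSEQ linfac_weight_summable linfac_weight_harm_summable)
  from LIMSEQ_unique[OF summable_LIMSEQ[OF linfac_weight_harm_summable] this] show ?thesis
    unfolding deriv_sum_def[of n] by simp
qed

text \<open>Dividing the recursion for \<open>deriv_sum\<close> by that for \<open>base_sum\<close>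
  makes the logarithmic derivatives additive.\<close>

lemma deriv_sum_quotient: "(\<Sum>i<n. ratio_log_deriv i) = deriv_sum 0 / base_sum 0 - deriv_sum n / base_sum n"
proof (induction n)
  case 0
  then show ?case by simp
next
  case (Suc n)
  have "deriv_sum n / base_sum n = ratio_log_deriv n + deriv_sum (Suc n) / base_sum (Suc n)"
    unfolding base_sum_recursion[of n] deriv_sum_recursion[of n]
    using ratio_pos[of n] base_sum_pos[of "Suc n"] by (simp add: field_simps)
  with Suc show ?case by simp
qed

text \<open>The quotient is a mean of the values \<open>harm_sum n k\<close> with positive weights,
  hence at most \<open>1/n\<close>.\<close>

lemma deriv_sum_quotient_tendsto: "(\<lambda>n. deriv_sum n / base_sum n) \<longlonglongrightarrow> 0"
proof (rule Lim_null_comparison)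
  show "(\<lambda>n. 1 / real n) \<longlonglongrightarrow> 0" by real_asymp
  show "\<forall>\<^sub>F n in sequentially. norm (deriv_sum n / base_sum n) \<le> 1 / real n"
    using eventually_gt_at_top[of 0]
  proof eventually_elim
    case (elim n)
    have nonneg: "0 \<le> deriv_sum n"
      unfolding deriv_sum_def using weight_pos[of n] linfac_pos[of n] harm_sum_nonneg[of n]
      by (intro suminf_nonneg linfac_weight_harm_summable) (simp add: less_imp_le)
    have "deriv_sum n \<le> (\<Sum>k. linfac n k * weight n 0 k * (1 / real n))"
      unfolding deriv_sum_def
      using weight_pos[of n] linfac_pos[of n] harm_sum_le_inverse[OF elim]
      by (intro suminf_le linfac_weight_harm_summable summable_mult2 linfac_weight_summable mult_left_mono)
        (simp_all add: less_imp_le)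
    also have "\<dots> = base_sum n * (1 / real n)"
      unfolding base_sum_def by (rule suminf_mult2[symmetric, OF linfac_weight_summable])
    finally have "deriv_sum n / base_sum n \<le> base_sum n * (1 / real n) / base_sum n"
      using base_sum_pos[of n] by (intro divide_right_mono) auto
    then show ?case
      using nonneg base_sum_pos[of n] by simp
  qed
qed

text \<open>The cubes of \<open>2n + 1\<close> and \<open>2n + 2\<close> together give
  \<open>zeta3\<close>, raising the coefficient 28 to 29.\<close>

lemma ratio_log_deriv_sums: "ratio_log_deriv sums ((29 * zeta3 - pi^3) / 8)"
proof -
  have "summable (\<lambda>k. 1 / real (Suc k) ^ 3)"
    using inverse_power_summable[of 3, where 'a = real] by (subst summable_Suc_iff) (simp add: inverse_eq_divide)
  then have z: "(\<lambda>k. 1 / real (Suc k) ^ 3) sums zeta3"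
    unfolding zeta3_def by (rule summable_sums)
  have "(\<lambda>n. \<Sum>k\<in>{n*2..<n*2+2}. 1 / real (Suc k) ^ 3) sums zeta3"
    by (rule sums_group[OF z]) simp
  then have "(\<lambda>n. 1 / (2 * real n + 1)^3 + 1 / (2 * real n + 2)^3) sums zeta3"
    by (simp add: numeral_2_eq_2 add_ac mult_ac)
  from sums_divide[OF sums_add[OF sum_inverse_cubes_three_quarters this], of 8] show ?thesis
    unfolding ratio_log_deriv_def by (simp add: add_ac)
qed

lemma deriv_sum_0: "deriv_sum 0 = base_sum 0 * ((29 * zeta3 - pi^3) / 8)"
proof -
  have "ratio_log_deriv sums (deriv_sum 0 / base_sum 0 - 0)"
    unfolding sums_def deriv_sum_quotient
    by (intro tendsto_diff tendsto_const deriv_sum_quotient_tendsto)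
  from sums_unique2[OF this ratio_log_deriv_sums]
  have "deriv_sum 0 / base_sum 0 = (29 * zeta3 - pi^3) / 8" by simp
  then show ?thesis using base_sum_pos[of 0] by (simp add: field_simps)
qed

section \<open>Identification with the stated series\<close>

lemma linfac_weight_0: "linfac 0 k * weight 0 0 k = gosper_term (1/4) k / 2"
proof -
  have "(\<Prod>j<k. upper 0 0 j / lower 0 0 j) = pochhammer (1/2) k ^ 3 / fact k ^ 3"
    by (induction k) (simp_all add: upper_def lower_def pochhammer_Suc power_mult_distrib add_ac mult_ac)
  then have "weight 0 0 k = gosper_weight (1/4) k"
    by (simp add: weight_def gosper_weight_def pochhammer_fact[symmetric] mult_ac)
  moreover have "linfac 0 k = (6 * real k + 1) / 2" by (simp add: linfac_def)
  ultimately show ?thesis unfolding gosper_term_def by simp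
qed

text \<open>Since \<open>1/(j + 1/2)^3 = 8/(2j + 1)^3\<close>, the half-integer part is a sum over
  odd cubes: all cubes up to \<open>2k\<close> minus the even ones.\<close>

lemma harm_sum_0: "8 * harm_sum 0 k = 8 * (8 * harm3 (2 * k) - harm3 k) + harm3 k"
proof (induction k)
  case 0
  then show ?case by (simp add: harm_sum_def harm3_def)
next
  case (Suc k)
  have h: "harm3 (Suc m) = harm3 m + 1 / (real m + 1)^3" for m
    by (simp add: harm3_def add.commute)
  have e: "harm3 (2 * Suc k) = harm3 (2 * k) + 1 / (2 * real k + 1)^3 + 1 / (2 * real k + 2)^3"
    using h[of "2 * k"] h[of "Suc (2 * k)"] by (simp add: add_ac)
  have s: "harm_sum 0 (Suc k) = harm_sum 0 k + (1 / (real k + 1/2)^3 + 1 / (8 * (real k + 1)^3))"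
    by (simp add: harm_sum_def)
  have "(2 * real k + 1)^3 = 8 * (real k + 1/2)^3" "(2 * real k + 2)^3 = 8 * (real k + 1)^3"
    by (simp_all add: power3_eq_cube algebra_simps)
  then show ?case unfolding s e h using Suc by simp
qed

theorem theorem1p2:
  shows "(\<lambda>n. let k = Suc n in
            (6 * real k + 1) / 4 ^ k
            * (pochhammer (1/2 :: real) k ^ 3 * pochhammer (1/4) k / pochhammer 1 k ^ 4)
            * (64 * harm3 (2 * k) - 7 * harm3 k))
         sums (sqrt 2 * Gamma (1/4 :: real) ^ 2 / pi powr (5/2) * (29 * zeta3 - pi ^ 3))"
proof -
  define f where "f k = (6 * real k + 1) / 4 ^ k
            * (pochhammer (1/2 :: real) k ^ 3 * pochhammer (1/4) k / pochhammer 1 k ^ 4)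
            * (64 * harm3 (2 * k) - 7 * harm3 k)" for k
  \<comment> \<open>The 16 is 2 from \<open>linfac 0 k = (6k + 1)/2\<close> times 8 from
    \<open>harm_sum_0\<close>.\<close>
  have f: "f k = 16 * (linfac 0 k * weight 0 0 k * harm_sum 0 k)" for k
  proof -
    have "16 * (linfac 0 k * weight 0 0 k * harm_sum 0 k) = gosper_term (1/4) k * (8 * harm_sum 0 k)"
      unfolding linfac_weight_0 by simp
    also have "8 * harm_sum 0 k = 64 * harm3 (2 * k) - 7 * harm3 k"
      unfolding harm_sum_0 by simp
    also have "gosper_term (1/4) k * (64 * harm3 (2 * k) - 7 * harm3 k) = f k"
      by (simp add: f_def gosper_term_def gosper_weight_def pochhammer_fact[symmetric] power3_eq_cube power4_eq_xxxx mult_ac)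
    finally show ?thesis ..
  qed
  have "base_sum 0 = suminf (gosper_term (1/4)) / 2"
    unfolding base_sum_def linfac_weight_0 by (rule suminf_divide) (simp add: gosper_summable)
  then have "16 * deriv_sum 0 = sqrt 2 * Gamma (1/4 :: real) ^ 2 / pi powr (5/2) * (29 * zeta3 - pi ^ 3)"
    unfolding deriv_sum_0 gosper_suminf_quarter by simp
  moreover have "f sums (16 * deriv_sum 0)"
    unfolding f deriv_sum_def by (intro sums_mult summable_sums linfac_weight_harm_summable)
  \<comment> \<open>The empty harmonic sums make the term at 0 vanish, so starting the series at 1
    does not change its value.\<close>
  moreover have "f 0 = 0" by (simp add: f_def harm3_def)
  ultimately have "(\<lambda>n. f (Suc n)) sums (sqrt 2 * Gamma (1/4 :: real) ^ 2 / pi powr (5/2) * (29 * zeta3 - pi ^ 3))"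
    by (simp add: sums_Suc_iff)
  then show ?thesis by (simp only: f_def Let_def)
qed

end
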